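(* For every $n\ge 1$ there is a constant $K_n$, depending only on $n$, such that for every $F=\sum_{(i,j,k)\in\Delta_n}F_{ijk}x^iy^jz^k\in\mathcal{H}_n$, every coordinate of the vector $\log(\partial(F))-\tfrac12\,\partial_0(\log F)$ has absolute value at most $K_n$; that is, $\log(\partial(F))=\tfrac12\,\partial_0(\log F)+O(1)$ where the $O(1)$ depends only on $n$. Here $\log$ acts on each coordinate, and $\log F$ denotes the function $(i,j,k)\mapsto\log F_{ijk}$ on $\Delta_n$.
   Context: $\Delta_n$ is the set of triples of nonnegative integers with sum $n$. $\mathcal{H}_n\subset\mathbb{R}[x,y,z]$ is the set of homogeneous degree $n$ polynomials of the form $\det(xX+yY+zZ)$ with $X,Y,Z$ positive definite Hermitian complex $n\times n$ matrices; all coefficients $F_{ijk}$ of such a polynomial are positive. For $F\in\mathcal{H}_n$, $\partial(F)$ is the triple of weakly decreasing $n$-tuples of positive reals consisting of the positive square roots of the zeros in $u$ (with multiplicity; all zeros are positive reals) of $F(-1,u,0)$, $F(0,-1,u)$ and $F(u,0,-1)$ respectively. For a function $h$ on $\Delta_n$, $$\begin{aligned}\partial_0 h=\big(&(h_{(n-1)10}-h_{n00},\,h_{(n-2)20}-h_{(n-1)10},\ldots,h_{0n0}-h_{1(n-1)0}),\\&(h_{0(n-1)1}-h_{0n0},\,h_{0(n-2)2}-h_{0(n-1)1},\ldots,h_{00n}-h_{01(n-1)}),\\&(h_{10(n-1)}-h_{00n},\,h_{20(n-2)}-h_{10(n-1)},\ldots,h_{n00}-h_{(n-1)01})\big).\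end{aligned}$$
   Formalization: In ∂(F) the zeros are those of F(u,-1,0), F(0,u,-1), F(-1,0,u), the reciprocals of the zeros of F(-1,u,0), F(0,-1,u), F(u,0,-1); with the latter the claim fails for n=1, F=ax+by+cz, where the first coordinate of the difference is log a - log b. *)

theory Defs
  imports
    Complex_Main
    "HOL-Library.Poly_Mapping"
    "HOL-Computational_Algebra.Polynomial"
    "Jordan_Normal_Form.Determinant"
    "Jordan_Normal_Form.Schur_Decomposition"
begin

definition Delta :: "nat \<Rightarrow> (nat \<times> nat \<times> nat) set" where
  "Delta n = {(i, j, k). i + j + k = n}"

text \<open>
  A polynomial in three variables is the finitely supported map sending an exponent triple
  to its coefficient.
\<close>
type_synonym 'a poly3 = "(nat \<times> nat \<times> nat) \<Rightarrow>\<^sub>0 'a"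

text \<open>
  Substitution for the three variables, with values in an algebra \<open>'b\<close> over the
  coefficients; \<open>\<iota>\<close> is the embedding of the coefficients into \<open>'b\<close>.
\<close>
definition subst3 :: "('a::zero \<Rightarrow> 'b::comm_ring_1) \<Rightarrow> 'a poly3 \<Rightarrow> 'b \<Rightarrow> 'b \<Rightarrow> 'b \<Rightarrow> 'b" where
  "subst3 \<iota> F x y z =
     (\<Sum>(i, j, k)\<in>Poly_Mapping.keys F. \<iota> (Poly_Mapping.lookup F (i, j, k)) * x ^ i * y ^ j * z ^ k)"

definition positive_definite :: "nat \<Rightarrow> complex mat \<Rightarrow> bool" where
  "positive_definite n A \<longleftrightarrow>
     A \<in> carrier_mat n n \<and> mat_adjoint A = A \<and>
     (\<forall>v\<in>carrier_vec n. v \<noteq> 0\<^sub>v n \<longrightarrow> Re ((A *\<^sub>v v) \<bullet>c v) > 0)"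

text \<open>
  The equation between \<open>F\<close> and the determinant is an identity of polynomials; both sides are
  polynomial in \<open>x, y, z\<close>, so it is expressed by equality at all real points.
\<close>
definition det_forms :: "nat \<Rightarrow> real poly3 set" where
  "det_forms n =
     {F. Poly_Mapping.keys F \<subseteq> Delta n \<and>
         (\<exists>X Y Z. positive_definite n X \<and> positive_definite n Y \<and> positive_definite n Z \<and>
            (\<forall>x y z :: real.
               complex_of_real (subst3 id F x y z) =
               det (complex_of_real x \<cdot>\<^sub>m X + complex_of_real y \<cdot>\<^sub>m Y + complex_of_real z \<cdot>\<^sub>m Z)))}"

definition sqrt_zeros :: "real poly \<Rightarrow> real list" where
  "sqrt_zeros p = rev (sorted_list_of_multiset (image_mset sqrt (proots p)))"

text \<open>
  Below, \<open>[:0, 1:]\<close> is the variable \<open>u\<close>, so the three univariate polynomials are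
  \<open>F(u,-1,0)\<close>, \<open>F(0,u,-1)\<close> and \<open>F(-1,0,u)\<close>.

  The source instead writes \<open>F(-1,u,0)\<close>, \<open>F(0,-1,u)\<close>, \<open>F(u,0,-1)\<close>, whose zeros are the
  reciprocals of these. That orientation does not match the one of \<open>boundary0\<close>: for
  \<open>F = a x + b y + c z\<close> the zero of \<open>F(-1,u,0)\<close> is \<open>a / b\<close>, whereas the first entry of
  \<open>boundary0 1 (log F)\<close> is \<open>log b - log a = log (b / a)\<close>. The difference of the logarithms, \<open>log a - log b\<close>, is unbounded, so
  the two slots are exchanged here.
\<close>
definition boundary :: "real poly3 \<Rightarrow> real list \<times> real list \<times> real list" where
  "boundary F =
     (sqrt_zeros (subst3 (\<lambda>c. [:c:]) F [:0, 1:] (-1) 0),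
      sqrt_zeros (subst3 (\<lambda>c. [:c:]) F 0 [:0, 1:] (-1)),
      sqrt_zeros (subst3 (\<lambda>c. [:c:]) F (-1) 0 [:0, 1:]))"

definition boundary0 ::
    "nat \<Rightarrow> (nat \<times> nat \<times> nat \<Rightarrow> real) \<Rightarrow> real list \<times> real list \<times> real list" where
  "boundary0 n h =
     (map (\<lambda>m. h (n - Suc m, Suc m, 0) - h (n - m, m, 0)) [0..<n],
      map (\<lambda>m. h (0, n - Suc m, Suc m) - h (0, n - m, m)) [0..<n],
      map (\<lambda>m. h (Suc m, 0, n - Suc m) - h (m, 0, n - m)) [0..<n])"

end

theory Submission
  imports Defs
begin

text \<open>
  Setting one variable to zero leaves the determinant of a pencil \<open>x X + y Y\<close> of two positive
  definite matrices. It factors as \<open>det X * (\<Prod>l. x + y * l)\<close>, where \<open>l\<close> runs through the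
  eigenvalues of \<open>X\<inverse> Y\<close>; these are positive reals, and \<open>det X\<close> is positive
  (\<open>positive_definite_pencil_factors\<close>, \<open>positive_definite_det\<close>). Two readings of this
  factorization give the two sides of the estimate. At \<open>(x, y) = (u, - 1)\<close> its zeros in \<open>u\<close>
  are the eigenvalues themselves. At \<open>(x, y) = (1, w)\<close> the coefficient of \<open>w ^ m\<close> is \<open>det X\<close>
  times the elementary symmetric function \<open>e m\<close> of the eigenvalues, and these coefficients are
  the values of \<open>F\<close> along one edge of the triangle.

  With the eigenvalues in decreasing order, \<open>e m\<close> is a sum of at most \<open>2 ^ n\<close> positive terms
  of which the product of the first \<open>m\<close> eigenvalues is the largest. Hence \<open>log (e m)\<close> exceeds
  the logarithm of that product by at most \<open>n * log 2\<close>, and the difference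
  \<open>log (e (m + 1)) - log (e m)\<close>, in which the factor \<open>det X\<close> has cancelled, is within
  \<open>n * log 2\<close> of the logarithm of the eigenvalue number \<open>m + 1\<close>. The square root in
  \<open>\<partial>\<close> halves everything, which gives the constant \<open>n * log 2 / 2\<close>.
\<close>

section \<open>Determinants of pencils of positive definite matrices\<close>

lemma hermitian_form_is_real:
  assumes A: "A \<in> carrier_mat n n" and adj: "mat_adjoint A = A" and v: "v \<in> carrier_vec n"
  shows "Im ((A *\<^sub>v v) \<bullet>c v) = 0"
proof -
  have sym: "cnj (A $$ (i, j)) = A $$ (j, i)" if "i < n" "j < n" for i j
  proof -
    have "A $$ (j, i) = mat_adjoint A $$ (j, i)" by (simp add: adj)
    also have "\<dots> = cnj (A $$ (i, j))"
      using A that by (simp add: mat_adjoint_def mat_of_rows_def)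
    finally show ?thesis by simp
  qed
  have form: "(A *\<^sub>v v) \<bullet>c v = (\<Sum>i<n. \<Sum>j<n. A $$ (i, j) * v $ j * cnj (v $ i))"
    using A v by (simp add: scalar_prod_def sum_distrib_right atLeast0LessThan)
  have "cnj ((A *\<^sub>v v) \<bullet>c v) = (\<Sum>i<n. \<Sum>j<n. A $$ (j, i) * cnj (v $ j) * v $ i)"
    unfolding form by (simp add: sym)
  also have "\<dots> = (\<Sum>j<n. \<Sum>i<n. A $$ (j, i) * cnj (v $ j) * v $ i)"
    by (rule sum.swap)
  also have "\<dots> = (A *\<^sub>v v) \<bullet>c v"
    unfolding form by (simp add: mult_ac)
  finally show ?thesis by (simp add: complex_eq_iff)
qed

lemma positive_definite_form:
  assumes "positive_definite n A" "v \<in> carrier_vec n" "v \<noteq> 0\<^sub>v n"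
  obtains r :: real where "r > 0" "(A *\<^sub>v v) \<bullet>c v = of_real r"
proof
  show "Re ((A *\<^sub>v v) \<bullet>c v) > 0"
    using assms by (simp add: positive_definite_def)
  show "(A *\<^sub>v v) \<bullet>c v = of_real (Re ((A *\<^sub>v v) \<bullet>c v))"
    using assms hermitian_form_is_real[of A n v]
    by (simp add: positive_definite_def complex_eq_iff)
qed

lemma positive_definite_det_nonzero:
  assumes "positive_definite n A"
  shows "det A \<noteq> 0"
proof
  assume "det A = 0"
  moreover have "A \<in> carrier_mat n n" using assms by (simp add: positive_definite_def)
  ultimately obtain v where v: "v \<in> carrier_vec n" "v \<noteq> 0\<^sub>v n" "A *\<^sub>v v = 0\<^sub>v n"
    using det_0_iff_vec_prod_zero by blast
  from positive_definite_form[OF assms v(1,2)] v show False by auto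
qed

lemma positive_definite_one: "positive_definite n (1\<^sub>m n)"
proof -
  have "mat_adjoint (1\<^sub>m n :: complex mat) = 1\<^sub>m n"
    by (rule eq_matI) (auto simp: mat_adjoint_def mat_of_rows_def)
  moreover have "Re (v \<bullet>c v) > 0" if "v \<in> carrier_vec n" "v \<noteq> 0\<^sub>v n" for v :: "complex vec"
    using conjugate_square_greater_0_vec[OF that(1)] that(2)
    by (simp add: less_complex_def)
  ultimately show ?thesis by (simp add: positive_definite_def)
qed

text \<open>
  Away from \<open>y = 0\<close> the left-hand side is, up to the factor \<open>(- y) ^ n\<close>, the
  characteristic polynomial at \<open>- x / y\<close>.
\<close>
lemma det_pencil_one:
  fixes A :: "complex mat"
  assumes A: "A \<in> carrier_mat n n"
    and as: "char_poly A = (\<Prod>a\<leftarrow>as. [:- a, 1:])" "length as = n"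
  shows "det (x \<cdot>\<^sub>m 1\<^sub>m n + y \<cdot>\<^sub>m A) = (\<Prod>a\<leftarrow>as. x + y * a)"
proof (cases "y = 0")
  case True
  have "0 \<cdot>\<^sub>m A = 0\<^sub>m n n" using A by auto
  then show ?thesis using True as(2) by (simp add: map_replicate_const prod_list_replicate)
next
  case False
  let ?k = "- x / y"
  have "x \<cdot>\<^sub>m 1\<^sub>m n + y \<cdot>\<^sub>m A = (- y) \<cdot>\<^sub>m (- char_matrix A ?k)"
    using A False by (intro eq_matI) (auto simp: char_matrix_def field_simps)
  then have "det (x \<cdot>\<^sub>m 1\<^sub>m n + y \<cdot>\<^sub>m A) = (- y) ^ n * poly (char_poly A) ?k"
    using A by (simp add: char_poly_matrix[OF A] char_matrix_def)
  also have "\<dots> = (\<Prod>a\<leftarrow>as. x + y * a)"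
    unfolding as(1) as(2)[symmetric]
  proof (induction as)
    case (Cons a as)
    have "(- y) * (?k - a) = x + y * a" using False by (simp add: field_simps)
    moreover have "(- y) ^ length (a # as) * poly (\<Prod>a\<leftarrow>a # as. [:- a, 1:]) ?k =
        ((- y) * (?k - a)) * ((- y) ^ length as * poly (\<Prod>a\<leftarrow>as. [:- a, 1:]) ?k)"
      by (simp add: algebra_simps)
    ultimately show ?case using Cons.IH by simp
  qed simp
  finally show ?thesis .
qed

text \<open>
  Each eigenvalue \<open>a\<close> of \<open>X\<inverse> Y\<close> satisfies \<open>Y v = a X v\<close> for some nonzero \<open>v\<close>, so it is the
  quotient of the two positive reals \<open>\<langle>Y v, v\<rangle>\<close> and \<open>\<langle>X v, v\<rangle>\<close>.
\<close>
lemma positive_definite_pencil_factors: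
  assumes X: "positive_definite n X" and Y: "positive_definite n Y"
  obtains ls :: "real list" where "length ls = n" "\<forall>l\<in>set ls. l > 0"
    "\<And>x y. det (x \<cdot>\<^sub>m X + y \<cdot>\<^sub>m Y) = det X * (\<Prod>l\<leftarrow>ls. x + y * of_real l)"
proof -
  have cX: "X \<in> carrier_mat n n" and cY: "Y \<in> carrier_mat n n"
    using X Y by (auto simp: positive_definite_def)
  \<comment> \<open>\<open>A\<close> is \<open>X\<inverse> Y\<close>, with the inverse given by the adjugate.\<close>
  define A where "A = (inverse (det X) \<cdot>\<^sub>m adj_mat X) * Y"
  have cA: "A \<in> carrier_mat n n" 
    unfolding A_def using adj_mat(1)[OF cX] cY by (intro mult_carrier_mat[of _ n n]) auto
  have XA: "X * A = Y"
  proof -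
    have "X * A = (X * (inverse (det X) \<cdot>\<^sub>m adj_mat X)) * Y"
      unfolding A_def using adj_mat(1)[OF cX] cX cY by (simp add: assoc_mult_mat[of _ n n _ n _ n])
    also have "X * (inverse (det X) \<cdot>\<^sub>m adj_mat X) = inverse (det X) \<cdot>\<^sub>m (X * adj_mat X)"
      using mult_smult_distrib[OF cX adj_mat(1)[OF cX]] .
    also have "\<dots> = 1\<^sub>m n"
      unfolding adj_mat(2)[OF cX] using positive_definite_det_nonzero[OF X]
      by (intro eq_matI) auto
    finally show ?thesis using cY by simp
  qed
  obtain as where as: "char_poly A = (\<Prod>a\<leftarrow>as. [:- a, 1:])" "length as = n"
    using char_poly_factorized[OF cA] by blast
  have pos: "Re a > 0 \<and> complex_of_real (Re a) = a" if a: "a \<in> set as" for a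
  proof -
    have "poly (char_poly A) a = 0"
      unfolding as(1) using a by (auto simp: poly_prod_list prod_list_zero_iff o_def)
    then obtain v where v: "v \<in> carrier_vec n" "v \<noteq> 0\<^sub>v n" and Av: "A *\<^sub>v v = a \<cdot>\<^sub>v v"
      using cA eigenvalue_root_char_poly[OF cA] by (auto simp: eigenvalue_def eigenvector_def)
    have "Y *\<^sub>v v = X *\<^sub>v (A *\<^sub>v v)"
      using assoc_mult_mat_vec[OF cX cA v(1)] XA by simp
    also have "\<dots> = a \<cdot>\<^sub>v (X *\<^sub>v v)"
      unfolding Av using mult_mat_vec[OF cX v(1)] .
    finally have "(Y *\<^sub>v v) \<bullet>c v = a * ((X *\<^sub>v v) \<bullet>c v)"
      using cX v by simp
    moreover obtain r where "r > 0" "(X *\<^sub>v v) \<bullet>c v = of_real r"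
      using positive_definite_form[OF X v] .
    moreover obtain s where "s > 0" "(Y *\<^sub>v v) \<bullet>c v = of_real s"
      using positive_definite_form[OF Y v] .
    ultimately have "a = of_real (s / r)" "s / r > 0"
      by (auto simp: field_simps)
    then show ?thesis by simp
  qed
  show ?thesis
  proof
    show "length (map Re as) = n" using as(2) by simp
    show "\<forall>l\<in>set (map Re as). l > 0" using pos by auto
    fix x y :: complex
    have "x \<cdot>\<^sub>m X + y \<cdot>\<^sub>m Y = X * (x \<cdot>\<^sub>m 1\<^sub>m n + y \<cdot>\<^sub>m A)"
    proof -
      have "X * (x \<cdot>\<^sub>m 1\<^sub>m n + y \<cdot>\<^sub>m A) = X * (x \<cdot>\<^sub>m 1\<^sub>m n) + X * (y \<cdot>\<^sub>m A)"
        using cX cA by (intro mult_add_distrib_mat[of _ n n _ n]) auto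
      then show ?thesis
        using cX cA XA by (simp add: mult_smult_distrib[of _ n n _ n])
    qed
    then have "det (x \<cdot>\<^sub>m X + y \<cdot>\<^sub>m Y) = det X * det (x \<cdot>\<^sub>m 1\<^sub>m n + y \<cdot>\<^sub>m A)"
      using cX cA det_mult[of X n "x \<cdot>\<^sub>m 1\<^sub>m n + y \<cdot>\<^sub>m A"] by simp
    also have "det (x \<cdot>\<^sub>m 1\<^sub>m n + y \<cdot>\<^sub>m A) = (\<Prod>a\<leftarrow>as. x + y * a)"
      using det_pencil_one[OF cA as] .
    also have "map (\<lambda>a. x + y * a) as = map (\<lambda>l. x + y * of_real l) (map Re as)"
      using pos by simp
    finally show "det (x \<cdot>\<^sub>m X + y \<cdot>\<^sub>m Y) = det X * (\<Prod>l\<leftarrow>map Re as. x + y * of_real l)" .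
  qed
qed

lemma of_real_prod_list: "complex_of_real (\<Prod>l\<leftarrow>ls. f l) = (\<Prod>l\<leftarrow>ls. of_real (f l))"
  by (induction ls) auto

text \<open>The pencil spanned by the identity and \<open>A\<close> writes \<open>det A\<close> as a product of positive reals.\<close>
lemma positive_definite_det:
  assumes "positive_definite n A"
  obtains a :: real where "a > 0" "det A = of_real a"
proof -
  obtain ls :: "real list" where "length ls = n" and ls: "\<forall>l\<in>set ls. l > 0"
    and det: "\<And>x y. det (x \<cdot>\<^sub>m 1\<^sub>m n + y \<cdot>\<^sub>m A) = det (1\<^sub>m n) * (\<Prod>l\<leftarrow>ls. x + y * of_real l)"
    by (rule positive_definite_pencil_factors[OF positive_definite_one assms]) (rule that)
  have "0 \<cdot>\<^sub>m 1\<^sub>m n + 1 \<cdot>\<^sub>m A = A"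
    using assms by (intro eq_matI) (auto simp: positive_definite_def)
  then have "det A = of_real (\<Prod>l\<leftarrow>ls. l)"
    using det[of 0 1] by (simp add: of_real_prod_list)
  moreover have "(\<Prod>l\<leftarrow>ls. l) > 0"
    using ls by (induction ls) auto
  ultimately show ?thesis using that by blast
qed

section \<open>Elementary symmetric functions of a decreasing sequence\<close>

text \<open>
  The coefficient is the elementary symmetric function of degree \<open>m\<close>. Its largest term is the
  product of the \<open>m\<close> largest entries, and it has at most \<open>2 ^ length ls\<close> terms.
\<close>
lemma elementary_symmetric_bounds:
  fixes ls :: "real list"
  assumes "sorted_wrt (\<ge>) ls" "\<forall>l\<in>set ls. l > 0" "m \<le> length ls"
  shows "prod_list (take m ls) \<le> coeff (\<Prod>l\<leftarrow>ls. [:1, l:]) m \<and>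
         coeff (\<Prod>l\<leftarrow>ls. [:1, l:]) m \<le> 2 ^ length ls * prod_list (take m ls)"
  using assms
proof (induction ls arbitrary: m)
  case (Cons l ls)
  define p where "p = (\<Prod>l\<leftarrow>ls. [:1, l:])"
  have IH: "prod_list (take k ls) \<le> coeff p k \<and>
      coeff p k \<le> 2 ^ length ls * prod_list (take k ls)" if "k \<le> length ls" for k
    using Cons that by (simp add: p_def)
  have l: "l > 0" using Cons.prems(2) by simp
  show ?case
  proof (cases m)
    case 0
    have "coeff (\<Prod>l\<leftarrow>xs. [:1, l:]) 0 = 1" for xs :: "real list"
      by (induction xs) (auto simp: coeff_mult)
    then show ?thesis
      using 0 one_le_power[of "2 :: real" "Suc (length ls)"] by (simp del: power_Suc)
  next
    case (Suc k)
    with Cons.prems(3) have k: "k \<le> length ls" by simp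
    define P where "P = prod_list (take k ls)"
    have P: "P \<ge> 0"
      unfolding P_def using Cons.prems(2) by (auto intro!: prod_list_nonneg dest!: in_set_takeD)
    have rec: "coeff (\<Prod>l\<leftarrow>l # ls. [:1, l:]) m = coeff p (Suc k) + l * coeff p k"
      by (simp add: Suc p_def)
    \<comment> \<open>Moving the last factor from \<open>ls ! k\<close> to the larger \<open>l\<close> bounds this summand by the same
      multiple of \<open>l * P\<close> as the other one; the sum of the two doubles the constant.\<close>
    have tail: "0 \<le> coeff p (Suc k) \<and> coeff p (Suc k) \<le> 2 ^ length ls * (l * P)"
    proof (cases "Suc k \<le> length ls")
      case True
      have "ls ! k \<le> l" "ls ! k > 0"
        using Cons.prems(1,2) True by auto
      moreover have "prod_list (take (Suc k) ls) = P * ls ! k"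
        using True by (simp add: take_Suc_conv_app_nth P_def)
      ultimately have "0 \<le> prod_list (take (Suc k) ls)" "prod_list (take (Suc k) ls) \<le> l * P"
        using P by (auto simp: mult.commute[of l] intro: mult_left_mono)
      moreover from this(2) have
        "2 ^ length ls * prod_list (take (Suc k) ls) \<le> 2 ^ length ls * (l * P)"
        by (intro mult_left_mono) auto
      ultimately show ?thesis using IH[OF True] by linarith
    next
      case False
      have "degree (\<Prod>l\<leftarrow>xs. [:1, l:]) \<le> length xs" for xs :: "real list"
      proof (induction xs)
        case (Cons x xs)
        have "degree ([:1, x:] * (\<Prod>l\<leftarrow>xs. [:1, l:])) \<le>
            degree [:1, x:] + degree (\<Prod>l\<leftarrow>xs. [:1, l:])"
          by (rule degree_mult_le)
        also have "\<dots> \<le> 1 + length xs" using Cons by (intro add_mono) auto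
        finally show ?case by simp
      qed simp
      then have "coeff p (Suc k) = 0"
        using False by (intro coeff_eq_0) (auto simp: p_def not_le intro: le_less_trans)
      then show ?thesis using P l by simp
    qed
    have "l * P \<le> l * coeff p k" "l * coeff p k \<le> l * (2 ^ length ls * P)"
      using IH[OF k] l by (auto simp: P_def)
    then show ?thesis
      unfolding rec using tail by (auto simp: Suc P_def algebra_simps)
  qed
qed simp

text \<open>
  Consecutive products of largest entries have quotient \<open>ls ! m\<close>. Each coefficient exceeds such
  a product on the logarithmic scale by an amount between \<open>0\<close> and \<open>length ls * ln 2\<close>, so the
  two errors partly cancel and are not doubled.
\<close>
lemma log_ratio_of_elementary_symmetric:
  fixes ls :: "real list"
  assumes "sorted_wrt (\<ge>) ls" "\<forall>l\<in>set ls. l > 0" "m < length ls" "a > 0"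
    and c: "\<And>k. k \<le> length ls \<Longrightarrow> c k = a * coeff (\<Prod>l\<leftarrow>ls. [:1, l:]) k"
  shows "\<bar>ln (ls ! m) - (ln (c (Suc m)) - ln (c m))\<bar> \<le> length ls * ln 2"
proof -
  let ?e = "coeff (\<Prod>l\<leftarrow>ls. [:1, l:])"
  have log: "0 \<le> ln (?e k) - ln (prod_list (take k ls)) \<and>
      ln (?e k) - ln (prod_list (take k ls)) \<le> length ls * ln 2 \<and> ?e k > 0 \<and>
      prod_list (take k ls) > 0"
    if k: "k \<le> length ls" for k
  proof -
    have "prod_list xs > 0" if "\<forall>x\<in>set xs. x > 0" for xs :: "real list"
      using that by (induction xs) auto
    then have P: "prod_list (take k ls) > 0"
      using assms(2) by (auto dest: in_set_takeD)
    note b = elementary_symmetric_bounds[OF assms(1,2) k]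
    with P have e: "?e k > 0" by linarith
    have "ln (?e k) \<le> ln (2 ^ length ls * prod_list (take k ls))"
      using b e P by (subst ln_le_cancel_iff) auto
    also have "\<dots> = length ls * ln 2 + ln (prod_list (take k ls))"
      using P by (simp only: ln_mult_pos ln_realpow zero_less_power zero_less_numeral)
    finally show ?thesis using b e P by (auto simp: ln_le_cancel_iff)
  qed
  have "ls ! m > 0" using assms(2,3) by simp
  moreover have "prod_list (take (Suc m) ls) = prod_list (take m ls) * ls ! m"
    using assms(3) by (simp add: take_Suc_conv_app_nth)
  ultimately have "ln (prod_list (take (Suc m) ls)) = ln (prod_list (take m ls)) + ln (ls ! m)"
    using log[of m] assms(3) by (simp only: ln_mult_pos)
  moreover have "ln (c k) = ln a + ln (?e k)" if "k \<le> length ls" for k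
    using log[OF that] \<open>a > 0\<close> c[OF that] by (simp add: ln_mult)
  ultimately show ?thesis
    using log[of m] log[of "Suc m"] assms(3) by (auto simp: abs_le_iff)
qed

section \<open>Restriction to an edge of the triangle\<close>

lemma sqrt_zeros_of_factors:
  fixes ls :: "real list"
  assumes p: "\<And>u. poly p u = a * (\<Prod>l\<leftarrow>ls. u - l)" and "a \<noteq> 0" "sorted_wrt (\<ge>) ls"
  shows "sqrt_zeros p = map sqrt ls"
proof -
  have "poly p = poly (smult a (\<Prod>l\<leftarrow>ls. [:- l, 1:]))"
    by (rule ext) (simp add: p poly_prod_list o_def)
  then have "p = smult a (\<Prod>l\<leftarrow>ls. [:- l, 1:])"
    by (simp only: poly_eq_poly_eq_iff)
  moreover have "proots (\<Prod>l\<leftarrow>ls. [:- l, 1:]) = mset ls"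
  proof (induction ls)
    case (Cons l ls)
    have "(\<Prod>l\<leftarrow>ls. [:- l, 1:]) \<noteq> 0" by (auto simp: prod_list_zero_iff)
    then have "proots ([:- l, 1:] * (\<Prod>l\<leftarrow>ls. [:- l, 1:])) =
        proots [:- l, 1:] + proots (\<Prod>l\<leftarrow>ls. [:- l, 1:])"
      by (intro proots_mult) auto
    with Cons show ?case by (simp del: mult_pCons_left)
  qed simp
  ultimately have "image_mset sqrt (proots p) = mset (rev (map sqrt ls))"
    using \<open>a \<noteq> 0\<close> by simp
  moreover have "sorted (rev (map sqrt ls))"
    using assms(3) by (simp add: sorted_wrt_rev sorted_wrt_map)
  ultimately show ?thesis
    unfolding sqrt_zeros_def by (metis rev_rev_ident sorted_list_of_multiset_mset sorted_sort_id)
qed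

text \<open>
  The estimate for one edge: \<open>p\<close> carries the zeros and \<open>c\<close> the coefficients of the same binary
  form, and both are expressed through the eigenvalues \<open>ls\<close> of the pencil.
\<close>
lemma positive_definite_pencil_edge:
  assumes X: "positive_definite n X" and Y: "positive_definite n Y"
    and p: "\<And>u :: real. of_real (poly p u) = det (of_real u \<cdot>\<^sub>m X + (- 1) \<cdot>\<^sub>m Y)"
    and c: "\<And>y :: real. of_real (\<Sum>m\<le>n. c m * y ^ m) = det (1 \<cdot>\<^sub>m X + of_real y \<cdot>\<^sub>m Y)"
  shows "list_all2 (\<lambda>r d. \<bar>ln r - 1 / 2 * d\<bar> \<le> n * ln 2 / 2)
    (sqrt_zeros p) (map (\<lambda>m. ln (c (Suc m)) - ln (c m)) [0..<n])"
proof -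
  obtain a where a: "a > 0" "det X = of_real a"
    using positive_definite_det[OF X] .
  obtain ks :: "real list" where ks: "length ks = n" "\<forall>l\<in>set ks. l > 0"
    and det_ks: "\<And>x y. det (x \<cdot>\<^sub>m X + y \<cdot>\<^sub>m Y) = det X * (\<Prod>l\<leftarrow>ks. x + y * of_real l)"
    by (rule positive_definite_pencil_factors[OF X Y]) (rule that)
  define ls where "ls = rev (sort ks)"
  have mset: "mset ls = mset ks" by (simp add: ls_def)
  have ls: "length ls = n" "\<forall>l\<in>set ls. l > 0" "sorted_wrt (\<ge>) ls"
    using ks by (simp_all add: ls_def sorted_wrt_rev)
  have det: "det (of_real x \<cdot>\<^sub>m X + of_real y \<cdot>\<^sub>m Y) = of_real (a * (\<Prod>l\<leftarrow>ls. x + y * l))" for x y :: real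
  proof -
    have "(\<Prod>l\<leftarrow>ks. x + y * l) = (\<Prod>l\<leftarrow>ls. x + y * l)"
      using mset by (metis mset_map prod_mset_prod_list)
    moreover have "det (of_real x \<cdot>\<^sub>m X + of_real y \<cdot>\<^sub>m Y) = of_real (a * (\<Prod>l\<leftarrow>ks. x + y * l))"
      by (simp add: det_ks a of_real_prod_list)
    ultimately show ?thesis by simp
  qed
  have "poly p u = a * (\<Prod>l\<leftarrow>ls. u - l)" for u
    using p[of u] det[of u "- 1"] by (simp del: of_real_mult add: of_real_eq_iff)
  then have zeros: "sqrt_zeros p = map sqrt ls"
    using a ls by (intro sqrt_zeros_of_factors) auto
  have "(\<Sum>m\<le>n. c m * y ^ m) = a * (\<Prod>l\<leftarrow>ls. 1 + y * l)" for y
    using c[of y] det[of 1 y] by (simp del: of_real_mult of_real_sum add: of_real_eq_iff)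
  then have "poly (\<Sum>m\<le>n. monom (c m) m) = poly (smult a (\<Prod>l\<leftarrow>ls. [:1, l:]))"
    by (intro ext) (simp add: poly_sum poly_monom poly_prod_list o_def)
  then have sum: "(\<Sum>m\<le>n. monom (c m) m) = smult a (\<Prod>l\<leftarrow>ls. [:1, l:])"
    by (simp only: poly_eq_poly_eq_iff)
  have coeffs: "c k = a * coeff (\<Prod>l\<leftarrow>ls. [:1, l:]) k" if "k \<le> length ls" for k
  proof -
    have "c k = coeff (\<Sum>m\<le>n. monom (c m) m) k"
      using that ls(1) by (simp add: coeff_sum)
    then show ?thesis unfolding sum by simp
  qed
  have "\<bar>ln (sqrt (ls ! m)) - 1 / 2 * (ln (c (Suc m)) - ln (c m))\<bar> \<le> n * ln 2 / 2"
    if "m < n" for m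
  proof -
    have "ln (sqrt (ls ! m)) = ln (ls ! m) / 2"
      using ls that by (intro ln_sqrt) (auto intro: less_imp_le)
    moreover have "\<bar>ln (ls ! m) - (ln (c (Suc m)) - ln (c m))\<bar> \<le> n * ln 2"
      using log_ratio_of_elementary_symmetric[OF ls(3,2) _ a(1) coeffs, of m] that ls(1) by simp
    ultimately show ?thesis unfolding abs_le_iff by argo
  qed
  then show ?thesis
    unfolding zeros using ls(1) by (simp add: list_all2_conv_all_nth)
qed

text \<open>
  Here \<open>e\<close> enumerates the exponents on one edge of \<open>Delta n\<close>, and \<open>vanish\<close> holds because the
  remaining exponents contain the variable that is set to zero.
\<close>
lemma subst3_along_edge:
  fixes x y z :: real
  assumes F: "Poly_Mapping.keys F \<subseteq> Delta n"
    and e: "inj_on e {..n}"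
    and vanish: "\<And>i j k. (i, j, k) \<in> Delta n - e ` {..n} \<Longrightarrow> x ^ i * y ^ j * z ^ k = 0"
    and mono: "\<And>m. m \<le> n \<Longrightarrow> (case e m of (i, j, k) \<Rightarrow> x ^ i * y ^ j * z ^ k) = w ^ m"
  shows "subst3 id F x y z = (\<Sum>m\<le>n. Poly_Mapping.lookup F (e m) * w ^ m)"
proof -
  let ?t = "\<lambda>(i, j, k). Poly_Mapping.lookup F (i, j, k) * x ^ i * y ^ j * z ^ k"
  have "subst3 id F x y z = sum ?t (Poly_Mapping.keys F)"
    by (simp add: subst3_def)
  also have "\<dots> = sum ?t (e ` {..n})"
  proof (rule sum.mono_neutral_cong)
    show "?t t = 0" if "t \<in> e ` {..n} - Poly_Mapping.keys F" for t
      using that by (cases t) (simp add: in_keys_iff)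
    show "?t t = 0" if "t \<in> Poly_Mapping.keys F - e ` {..n}" for t
      using that F vanish by (cases t) (auto simp: mult.assoc)
  qed auto
  also have "\<dots> = (\<Sum>m\<le>n. ?t (e m))"
    using e by (simp add: sum.reindex)
  also have "\<dots> = (\<Sum>m\<le>n. Poly_Mapping.lookup F (e m) * w ^ m)"
  proof (rule sum.cong)
    show "?t (e m) = Poly_Mapping.lookup F (e m) * w ^ m" if "m \<in> {..n}" for m
      using mono[of m] that by (cases "e m") (simp add: mult.assoc)
  qed simp
  finally show ?thesis .
qed

lemma poly_subst3:
  "poly (subst3 (\<lambda>c. [:c:]) F p q r) u = subst3 id F (poly p u) (poly q u) (poly r u)"
  for F :: "real poly3"
  by (simp add: subst3_def poly_sum case_prod_unfold mult_ac)

theorem proposition12: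
  fixes n :: nat
  assumes "n \<ge> 1"
  shows "\<exists>K :: real. \<forall>F \<in> det_forms n.
           (let close = list_all2 (\<lambda>r d. \<bar>ln r - 1 / 2 * d\<bar> \<le> K)
            in rel_prod close (rel_prod close close)
                 (boundary F) (boundary0 n (\<lambda>t. ln (Poly_Mapping.lookup F t))))"
proof (intro exI ballI)
  fix F assume "F \<in> det_forms n"
  then obtain X Y Z where keys: "Poly_Mapping.keys F \<subseteq> Delta n"
    and X: "positive_definite n X" and Y: "positive_definite n Y" and Z: "positive_definite n Z"
    and det: "\<And>x y z :: real. of_real (subst3 id F x y z) =
               det (of_real x \<cdot>\<^sub>m X + of_real y \<cdot>\<^sub>m Y + of_real z \<cdot>\<^sub>m Z)"
    unfolding det_forms_def by blast
  have carrier: "X \<in> carrier_mat n n" "Y \<in> carrier_mat n n" "Z \<in> carrier_mat n n"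
    using X Y Z by (auto simp: positive_definite_def)
  have xy: "of_real (subst3 id F x y 0) = det (of_real x \<cdot>\<^sub>m X + of_real y \<cdot>\<^sub>m Y)" for x y
    unfolding det using carrier by (intro arg_cong[where f = det] eq_matI) auto
  have yz: "of_real (subst3 id F 0 y z) = det (of_real y \<cdot>\<^sub>m Y + of_real z \<cdot>\<^sub>m Z)" for y z
    unfolding det using carrier by (intro arg_cong[where f = det] eq_matI) auto
  have zx: "of_real (subst3 id F x 0 z) = det (of_real z \<cdot>\<^sub>m Z + of_real x \<cdot>\<^sub>m X)" for x z
    unfolding det using carrier by (intro arg_cong[where f = det] eq_matI) auto
  have edge_xy: "subst3 id F 1 w 0 = (\<Sum>m\<le>n. Poly_Mapping.lookup F (n - m, m, 0) * w ^ m)" for w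
    by (rule subst3_along_edge[OF keys]) (auto simp: inj_on_def Delta_def image_iff)
  have edge_yz: "subst3 id F 0 1 w = (\<Sum>m\<le>n. Poly_Mapping.lookup F (0, n - m, m) * w ^ m)" for w
    by (rule subst3_along_edge[OF keys]) (auto simp: inj_on_def Delta_def image_iff)
  have edge_zx: "subst3 id F w 0 1 = (\<Sum>m\<le>n. Poly_Mapping.lookup F (m, 0, n - m) * w ^ m)" for w
    by (rule subst3_along_edge[OF keys]) (auto simp: inj_on_def Delta_def image_iff)
  \<comment> \<open>The leading matrix of each pencil belongs to the variable that \<open>boundary\<close> keeps as
    unknown, so that the zeros, and not their reciprocals, are matched with \<open>boundary0\<close>.\<close>
  note close_xy = positive_definite_pencil_edge[OF X Y,
      of "subst3 (\<lambda>c. [:c:]) F [:0, 1:] (- 1) 0" "\<lambda>m. Poly_Mapping.lookup F (n - m, m, 0)"]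
  note close_yz = positive_definite_pencil_edge[OF Y Z,
      of "subst3 (\<lambda>c. [:c:]) F 0 [:0, 1:] (- 1)" "\<lambda>m. Poly_Mapping.lookup F (0, n - m, m)"]
  note close_zx = positive_definite_pencil_edge[OF Z X,
      of "subst3 (\<lambda>c. [:c:]) F (- 1) 0 [:0, 1:]" "\<lambda>m. Poly_Mapping.lookup F (m, 0, n - m)"]
  show "let close = list_all2 (\<lambda>r d. \<bar>ln r - 1 / 2 * d\<bar> \<le> n * ln 2 / 2)
        in rel_prod close (rel_prod close close)
             (boundary F) (boundary0 n (\<lambda>t. ln (Poly_Mapping.lookup F t)))"
    unfolding Let_def boundary_def boundary0_def rel_prod_inject
    by (intro conjI close_xy close_yz close_zx)
      (simp_all add: poly_subst3 xy yz zx flip: edge_xy edge_yz edge_zx)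
qed

end
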